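(* Let $(X,T)$ be a dynamical system. Then the following conditions are equivalent: (1) $(X,T)$ is $\Delta$-transitive; (2) the collection of hitting time sets $\{N(U_1,U_2,\dots,U_d)\colon d\ge2$ and $U_1,U_2,\dots,U_d$ are non-empty open subsets of $X\}$ is a filter base; (3) for every $d\ge2$ and all non-empty open subsets $U_1,U_2,\dots,U_d$ of $X$, $N(U_1,U_2,\dots,U_d)$ is thick; (4) for every $m\ge2$, $(X^m,T^{(m)})$ is $\Delta$-transitive.
   Context: A dynamical system $(X,T)$ is a compact metric space with a continuous map $T\colon X\to X$. $\mathbb{N}$ is the set of positive integers and $\mathbb{Z}_+$ the set of non-negative integers. $T^{(m)}=T\times\cdots\times T$ ($m$ times) acts on $X^m$. A system $(X,T)$ is $\Delta$-transitive if for every $d\ge2$ there is a residual subset $X_0$ of $X$ such that for every $x\in X_0$ the set $\{(T^nx,T^{2n}x,\dots,T^{dn}x)\colon n\in\mathbb{Z}_+\}$ is dense in $X^d$. For subsets $U_1,\dots,U_d$ of $X$ ($d\ge2$), $N(U_1,\dots,U_d)=\{n\in\mathbb{N}\colon\bigcap_{i=1}^d T^{-(i-1)n}U_i\neq\emptyset\}$. A subset $F$ of $\mathbb{N}$ is thick if for every $N\ge1$ there is $n\in\mathbb{N}$ with $\{n,n+1,\dots,n+N\}\subset F$. A collection $\mathcal F$ of subsets of $\mathbb{N}$ is a filter base if for any $F_1,F_2\in\mathcal F$ there exists a non-empty set $F\in\mathcal F$ with $F\subset F_1\cap F_2$. *)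

theory Defs
  imports "HOL-Analysis.Analysis"
begin

text \<open>
  A system is a carrier topology \<open>X\<close> together with a map \<open>T\<close>. The compact metric enters only through
  its topology, so it is recorded by metrizability; in this way the powers \<open>X\<^sup>m\<close>, with the product
  topology and \<open>m\<close> a term rather than a type, are systems in the same sense. The
  empty system is admitted.
\<close>

definition dynamical_system :: "'a topology \<Rightarrow> ('a \<Rightarrow> 'a) \<Rightarrow> bool" where
  "dynamical_system X T \<longleftrightarrow>
     compact_space X \<and> metrizable_space X \<and> continuous_map X X T"

text \<open>Points of \<open>X\<^sup>m\<close> are the functions on \<open>{1..m}\<close> that are \<open>undefined\<close> elsewhere.\<close>

definition power_top :: "nat \<Rightarrow> 'a topology \<Rightarrow> (nat \<Rightarrow> 'a) topology" where
  "power_top m X = product_topology (\<lambda>_. X) {1..m}"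

definition power_map :: "nat \<Rightarrow> ('a \<Rightarrow> 'a) \<Rightarrow> (nat \<Rightarrow> 'a) \<Rightarrow> (nat \<Rightarrow> 'a)" where
  "power_map m T x = (\<lambda>i\<in>{1..m}. T (x i))"

definition dense_in :: "'a topology \<Rightarrow> 'a set \<Rightarrow> bool" where
  "dense_in X S \<longleftrightarrow> S \<subseteq> topspace X \<and> X closure_of S = topspace X"

text \<open>The intersection with \<open>topspace X\<close> matters only for the empty family.\<close>

definition residual_in :: "'a topology \<Rightarrow> 'a set \<Rightarrow> bool" where
  "residual_in X S \<longleftrightarrow> S \<subseteq> topspace X \<and>
     (\<exists>\<G>. countable \<G> \<and> (\<forall>G\<in>\<G>. openin X G \<and> dense_in X G) \<and> topspace X \<inter> \<Inter>\<G> \<subseteq> S)"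

definition Delta_transitive :: "'a topology \<Rightarrow> ('a \<Rightarrow> 'a) \<Rightarrow> bool" where
  "Delta_transitive X T \<longleftrightarrow>
     (\<forall>d\<ge>2. \<exists>X0. residual_in X X0 \<and>
        (\<forall>x\<in>X0. dense_in (power_top d X) (range (\<lambda>n::nat. \<lambda>i\<in>{1..d}. (T ^^ (i * n)) x))))"

definition hitting_times :: "'a topology \<Rightarrow> ('a \<Rightarrow> 'a) \<Rightarrow> nat \<Rightarrow> (nat \<Rightarrow> 'a set) \<Rightarrow> nat set" where
  "hitting_times X T d U =
     {n. 1 \<le> n \<and> (\<Inter>i\<in>{1..d}. {x \<in> topspace X. (T ^^ ((i - 1) * n)) x \<in> U i}) \<noteq> {}}"

definition nonempty_opens :: "'a topology \<Rightarrow> nat \<Rightarrow> (nat \<Rightarrow> 'a set) \<Rightarrow> bool" where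
  "nonempty_opens X d U \<longleftrightarrow> (\<forall>i\<in>{1..d}. openin X (U i) \<and> U i \<noteq> {})"

definition thick :: "nat set \<Rightarrow> bool" where
  "thick F \<longleftrightarrow> (\<forall>N\<ge>1. \<exists>n\<ge>1. {n..n + N} \<subseteq> F)"

definition filter_base :: "nat set set \<Rightarrow> bool" where
  "filter_base \<F> \<longleftrightarrow> (\<forall>F1\<in>\<F>. \<forall>F2\<in>\<F>. \<exists>F\<in>\<F>. F \<noteq> {} \<and> F \<subseteq> F1 \<inter> F2)"

lemma (in Metric_space) dynamical_system_mtopology:
  assumes "compact_space mtopology" "continuous_map mtopology mtopology T"
  shows "dynamical_system mtopology T"
  using assms by (simp add: dynamical_system_def metrizable_space_mtopology)

lemma dynamical_system_power:
  assumes "dynamical_system X T"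
  shows "dynamical_system (power_top m X) (power_map m T)"
proof -
  have "continuous_map (power_top m X) (power_top m X) (power_map m T)"
    unfolding power_top_def power_map_def continuous_map_componentwise
  proof (intro conjI ballI)
    fix i assume "i \<in> {1..m}"
    then have "continuous_map (product_topology (\<lambda>_. X) {1..m}) X (\<lambda>x. T (x i))"
      using assms continuous_map_compose[OF continuous_map_product_projection, of i "{1..m}" "\<lambda>_. X" X T]
      by (simp add: dynamical_system_def o_def)
    then show "continuous_map (product_topology (\<lambda>_. X) {1..m}) X (\<lambda>x. (\<lambda>i\<in>{1..m}. T (x i)) i)"
      using \<open>i \<in> {1..m}\<close> by simp
  qed auto
  then show ?thesis
    using assms
    by (auto simp: dynamical_system_def power_top_def compact_space_product_topology
        metrizable_space_product_topology intro: countable_subset)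
qed

end

theory Submission
  imports Defs
begin

text \<open>
  All four conditions are equivalent to the non-emptiness of every hitting time set. For
  \<open>\<Delta>\<close>-transitivity this is a Baire category argument. If \<open>x\<close> runs through
  \<open>U\<^sub>1, \<dots>, U\<^sub>d, V\<^sub>1, \<dots>, V\<^sub>e\<close> along an arithmetic progression of times with step \<open>n\<close>, then
  \<open>x\<close> and \<open>T\<^bsup>dn\<^esup>x\<close> witness that \<open>n\<close> is a hitting time of both \<open>U\<close> and \<open>V\<close>; so hitting time sets
  always form a filter base once they are non-empty. Thickness then follows by intersecting the
  hitting time sets of the families \<open>T\<^bsup>-(i-1)j\<^esup>U\<^sub>i\<close> for \<open>j \<le> N\<close>, and the passage to \<open>X\<^sup>m\<close> by
  intersecting those of the coordinate families of boxes.
\<close>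

section \<open>Hitting times and iterates\<close>

definition always_hitting :: "'a topology \<Rightarrow> ('a \<Rightarrow> 'a) \<Rightarrow> bool" where
  "always_hitting X T \<longleftrightarrow> (\<forall>d\<ge>2. \<forall>U. nonempty_opens X d U \<longrightarrow> hitting_times X T d U \<noteq> {})"

lemma hitting_timesI:
  assumes "1 \<le> n" "x \<in> topspace X" "\<And>i. i \<in> {1..d} \<Longrightarrow> (T ^^ ((i - 1) * n)) x \<in> U i"
  shows "n \<in> hitting_times X T d U"
  using assms unfolding hitting_times_def by blast

lemma hitting_timesE:
  assumes "n \<in> hitting_times X T d U" "1 \<le> d"
  obtains x where "1 \<le> n" "x \<in> topspace X"
    "\<And>i. i \<in> {1..d} \<Longrightarrow> (T ^^ ((i - 1) * n)) x \<in> U i"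
proof -
  obtain x where "1 \<le> n" "x \<in> (\<Inter>i\<in>{1..d}. {x \<in> topspace X. (T ^^ ((i - 1) * n)) x \<in> U i})"
    using assms(1) unfolding hitting_times_def by blast
  \<comment> \<open>Over an empty index set the intersection would be \<open>UNIV\<close>; index 1
    is what forces \<open>x\<close> into \<open>topspace X\<close>.\<close>
  moreover have "1 \<in> {1..d}" using assms(2) by simp
  ultimately show thesis using that by blast
qed

lemma continuous_map_funpow:
  assumes "continuous_map X X T"
  shows "continuous_map X X (T ^^ k)"
proof (induction k)
  case 0
  then show ?case by (simp add: id_def)
next
  case (Suc k)
  then show ?case using continuous_map_compose[OF Suc assms] by (simp add: o_def)
qed

lemma funpow_in_topspace:
  assumes "continuous_map X X T" "x \<in> topspace X"
  shows "(T ^^ k) x \<in> topspace X"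
  using continuous_map_funpow[OF assms(1), of k] assms(2) by (auto simp: continuous_map_def)

section \<open>Second countability and Baire category in compact metric spaces\<close>

text \<open>Total boundedness gives a finite net for each radius 1/(n+1); the balls of these radii
  around the net points form a countable base.\<close>

lemma (in Metric_space) compact_imp_second_countable:
  assumes "compact_space mtopology"
  shows "second_countable mtopology"
proof -
  have tb: "mtotally_bounded M"
    using assms compactin_imp_mtotally_bounded by (simp add: compact_space_def)
  have "\<exists>K. finite K \<and> K \<subseteq> M \<and> M \<subseteq> (\<Union>x\<in>K. mball x (inverse (real (Suc n))))" for n
    using tb unfolding mtotally_bounded_def by simp
  then obtain K where K: "\<And>n. finite (K n)" "\<And>n. K n \<subseteq> M"
      "\<And>n. M \<subseteq> (\<Union>x\<in>K n. mball x (inverse (real (Suc n))))"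
    by metis
  define B where "B = (\<Union>n. (\<lambda>x. mball x (inverse (real (Suc n)))) ` K n)"
  have "\<exists>V\<in>B. x \<in> V \<and> V \<subseteq> U" if U: "openin mtopology U" "x \<in> U" for U x
  proof -
    obtain r where r: "r > 0" "mball x r \<subseteq> U" and xM: "x \<in> M"
      using U unfolding openin_mtopology by blast
    \<comment> \<open>Half of \<open>r\<close> leaves room for the detour through the centre
      \<open>c\<close> of the net ball.\<close>
    obtain n where n: "inverse (real (Suc n)) < r / 2"
      using reals_Archimedean r(1) half_gt_zero by blast
    obtain c where c: "c \<in> K n" "x \<in> mball c (inverse (real (Suc n)))"
      using K(3) xM by blast
    have "mball c (inverse (real (Suc n))) \<subseteq> mball x r"
    proof
      fix y assume y: "y \<in> mball c (inverse (real (Suc n)))"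
      have "d x y \<le> d x c + d c y"
        using c y xM by (intro triangle) auto
      also have "\<dots> < r"
        using c y n by (simp add: commute)
      finally show "y \<in> mball x r" using y xM by auto
    qed
    then show ?thesis using c r(2) unfolding B_def by blast
  qed
  moreover have "countable B"
    unfolding B_def using K(1) by (auto intro: countable_finite)
  moreover have "\<forall>V\<in>B. openin mtopology V"
    unfolding B_def by auto
  ultimately show ?thesis
    unfolding second_countable_def by blast
qed

lemma compact_metrizable_imp_second_countable:
  assumes "compact_space X" "metrizable_space X"
  shows "second_countable X"
  using assms Metric_space.compact_imp_second_countable unfolding metrizable_space_def by metis

text \<open>Baire's theorem applies because a compact metrizable space is locally compact and
  regular.\<close>

lemma residual_in_meets_open:
  assumes "compact_space X" "metrizable_space X" "residual_in X R" "openin X V" "V \<noteq> {}"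
  shows "R \<inter> V \<noteq> {}"
proof -
  obtain \<G> where \<G>: "countable \<G>" "\<forall>G\<in>\<G>. openin X G \<and> dense_in X G"
      "topspace X \<inter> \<Inter>\<G> \<subseteq> R"
    using assms(3) unfolding residual_in_def by blast
  have "X closure_of \<Inter>\<G> = topspace X"
  proof (rule Baire_category)
    show "completely_metrizable_space X \<or> locally_compact_space X \<and> regular_space X"
      using assms(1,2) compact_imp_locally_compact_space metrizable_imp_regular_space by blast
  qed (use \<G> in \<open>auto simp: dense_in_def\<close>)
  then have "\<Inter>\<G> \<inter> V \<noteq> {}"
    using assms(4,5) by (simp add: dense_intersects_open)
  then show ?thesis
    using \<G>(3) openin_subset[OF assms(4)] by blast
qed

section \<open>Density in powers\<close>

text \<open>Open boxes form a base of the product topology. Density of a progression thus becomes a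
  statement about visits to finitely many open sets of \<open>X\<close>.\<close>

lemma dense_in_power_top_iff:
  "dense_in (power_top d X) S \<longleftrightarrow> S \<subseteq> topspace (power_top d X) \<and>
     (\<forall>W. nonempty_opens X d W \<longrightarrow> (\<exists>s\<in>S. \<forall>i\<in>{1..d}. s i \<in> W i))"
  (is "?L \<longleftrightarrow> ?R")
proof
  assume L: ?L
  show ?R
  proof (intro conjI allI impI)
    show sub: "S \<subseteq> topspace (power_top d X)"
      using L by (simp add: dense_in_def)
    fix W assume W: "nonempty_opens X d W"
    have "openin (power_top d X) (Pi\<^sub>E {1..d} W)" "Pi\<^sub>E {1..d} W \<noteq> {}"
      using W by (auto simp: power_top_def nonempty_opens_def openin_PiE_gen PiE_eq_empty_iff)
    then have "S \<inter> Pi\<^sub>E {1..d} W \<noteq> {}"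
      using L by (simp add: dense_in_def dense_intersects_open)
    then show "\<exists>s\<in>S. \<forall>i\<in>{1..d}. s i \<in> W i"
      by (auto simp: PiE_iff)
  qed
next
  assume R: ?R
  have "S \<inter> V \<noteq> {}" if V: "openin (power_top d X) V" "V \<noteq> {}" for V
  proof -
    obtain v where "v \<in> V" using V by blast
    then obtain W where W: "\<forall>i\<in>{1..d}. openin X (W i)" "v \<in> Pi\<^sub>E {1..d} W" "Pi\<^sub>E {1..d} W \<subseteq> V"
      using V(1) unfolding power_top_def openin_product_topology_alt by blast
    then have "nonempty_opens X d W"
      by (auto simp: nonempty_opens_def PiE_iff)
    then obtain s where s: "s \<in> S" "\<forall>i\<in>{1..d}. s i \<in> W i"
      using R by blast
    \<comment> \<open>Lying in the box also means being \<open>undefined\<close> off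
      \<open>{1..d}\<close>; this comes from \<open>S\<close> being part of the product
      space.\<close>
    moreover have "s \<in> extensional {1..d}"
      using R s(1) by (auto simp: power_top_def PiE_iff)
    ultimately have "s \<in> Pi\<^sub>E {1..d} W" by (simp add: PiE_iff)
    then show ?thesis using W(3) s(1) by blast
  qed
  then show ?L using R by (simp add: dense_in_def dense_intersects_open)
qed

lemma progression_in_power_top:
  assumes "continuous_map X X T" "x \<in> topspace X"
  shows "range (\<lambda>n::nat. \<lambda>i\<in>{1..d}. (T ^^ (i * n)) x) \<subseteq> topspace (power_top d X)"
  using funpow_in_topspace[OF assms] by (auto simp: power_top_def)

section \<open>Delta-transitivity and non-empty hitting time sets\<close>

text \<open>A residual set meets \<open>U 1\<close>, and density of the progression of a point there
  sends it into the remaining sets. The obstacle is the time 0, which density allows but hitting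
  times do not.\<close>

lemma Delta_transitive_imp_always_hitting:
  assumes X: "dynamical_system X T" and D: "Delta_transitive X T"
  shows "always_hitting X T"
  unfolding always_hitting_def
proof (intro allI impI)
  fix d :: nat and U assume d: "2 \<le> d" and U: "nonempty_opens X d U"
  have T: "continuous_map X X T" and cpt: "compact_space X" and met: "metrizable_space X"
    using X by (auto simp: dynamical_system_def)
  have "openin X (U 1)" "U 1 \<noteq> {}" using U d by (auto simp: nonempty_opens_def)
  then obtain y where y: "y \<in> U 1" "y \<in> topspace X"
    using openin_subset by blast
  show "hitting_times X T d U \<noteq> {}"
  \<comment> \<open>Excluding time 0 takes a second point to separate from \<open>y\<close>. In a
    one-point space every non-empty open set is the whole space, and time 1 works.\<close>
  proof (cases "topspace X = {y}")
    case True
    have "U i = {y}" if "i \<in> {1..d}" for i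
      using U that True openin_subset[of X "U i"] by (auto simp: nonempty_opens_def)
    moreover have "(T ^^ k) y = y" for k
      using funpow_in_topspace[OF T y(2), of k] True by simp
    ultimately have "1 \<in> hitting_times X T d U"
      using d y(2) by (intro hitting_timesI[of _ y]) auto
    then show ?thesis by blast
  next
    case False
    then obtain z where z: "z \<in> topspace X" "z \<noteq> y" using y(2) by blast
    then obtain A B where AB: "openin X A" "openin X B" "y \<in> A" "z \<in> B" "disjnt A B"
      using metrizable_imp_Hausdorff_space[OF met] y(2) unfolding Hausdorff_space_def by metis
    \<comment> \<open>Requiring \<open>T\<^bsup>dn\<^esup>x \<in> B\<close> for a point \<open>x \<notin> B\<close> excludes the time \<open>n = 0\<close>.\<close>
    define W where "W i = (if i < d then U (i + 1) else B)" for i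
    have W: "nonempty_opens X d W"
      using U AB(2,4) by (auto simp: nonempty_opens_def W_def)
    obtain R where R: "residual_in X R"
        "\<And>x. x \<in> R \<Longrightarrow> dense_in (power_top d X) (range (\<lambda>n::nat. \<lambda>i\<in>{1..d}. (T ^^ (i * n)) x))"
      using D d unfolding Delta_transitive_def by blast
    have "R \<inter> (A \<inter> U 1) \<noteq> {}"
      using residual_in_meets_open[OF cpt met R(1), of "A \<inter> U 1"] AB(1,3) y(1) \<open>openin X (U 1)\<close>
      by blast
    then obtain x where x: "x \<in> R" "x \<in> A" "x \<in> U 1" by blast
    then obtain n where n: "\<And>i. i \<in> {1..d} \<Longrightarrow> (T ^^ (i * n)) x \<in> W i"
      using R(2)[OF x(1)] W unfolding dense_in_power_top_iff by fastforce
    have "n \<noteq> 0"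
      using n[of d] d x(2) AB(5) by (auto simp: W_def disjnt_def)
    \<comment> \<open>The progression starts with T^n x but hitting times with x itself, so index
      \<open>i\<close> is read off entry \<open>i - 1\<close>, and index 1 off the choice of
      \<open>x\<close>.\<close>
    moreover have "(T ^^ ((i - 1) * n)) x \<in> U i" if "i \<in> {1..d}" for i
    proof (cases "i = 1")
      case False
      then have "i - 1 \<in> {1..d}" "i - 1 < d" "i - 1 + 1 = i" using that by auto
      then show ?thesis using n[of "i - 1"] by (simp add: W_def)
    qed (use x in simp)
    moreover have "x \<in> topspace X"
      using x(2) AB(1) openin_subset by blast
    ultimately have "n \<in> hitting_times X T d U"
      by (intro hitting_timesI) auto
    then show ?thesis by blast
  qed
qed

text \<open>For each tuple \<open>W\<close> from a countable base, the points whose progression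
  visits \<open>W\<close> form an open set, which is dense because longer families have hitting
  times. The intersection over all \<open>W\<close> is the residual set.\<close>

lemma always_hitting_imp_Delta_transitive:
  assumes X: "dynamical_system X T" and H: "always_hitting X T"
  shows "Delta_transitive X T"
  unfolding Delta_transitive_def
proof (intro allI impI)
  fix d :: nat assume d: "2 \<le> d"
  have T: "continuous_map X X T" and cpt: "compact_space X" and met: "metrizable_space X"
    using X by (auto simp: dynamical_system_def)
  obtain \<B> where "countable \<B>" "\<forall>V\<in>\<B>. openin X V"
      and base: "\<forall>U x. openin X U \<and> x \<in> U \<longrightarrow> (\<exists>V\<in>\<B>. x \<in> V \<and> V \<subseteq> U)"
    using compact_metrizable_imp_second_countable[OF cpt met]
    unfolding second_countable_def by (elim exE conjE)
  then have \<B>: "countable \<B>" "\<And>V. V \<in> \<B> \<Longrightarrow> openin X V"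
    by auto
  \<comment> \<open>Extensional functions on a finite index set keep this family countable; the
    empty set is dropped because the density argument needs every entry of \<open>W\<close>
    non-empty.\<close>
  define \<P> where "\<P> = (\<Pi>\<^sub>E i\<in>{1..d}. \<B> - {{}})"
  define G where "G W = (\<Union>n. \<Inter>i\<in>{1..d}. {x \<in> topspace X. (T ^^ (i * n)) x \<in> W i})" for W
  have G_iff: "x \<in> G W \<longleftrightarrow> x \<in> topspace X \<and> (\<exists>n. \<forall>i\<in>{1..d}. (T ^^ (i * n)) x \<in> W i)" for x W
  proof -
    have "{1..d} \<noteq> {}" using d by simp
    then show ?thesis unfolding G_def by blast
  qed
  define R where "R = topspace X \<inter> \<Inter>(G ` \<P>)"
  have "openin X (G W)" if "W \<in> \<P>" for W
    unfolding G_def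
  proof (rule openin_Union, elim rangeE, hypsubst)
    fix n
    show "openin X (\<Inter>i\<in>{1..d}. {x \<in> topspace X. (T ^^ (i * n)) x \<in> W i})"
    proof (rule openin_INT2)
      fix i assume "i \<in> {1..d}"
      then have "openin X (W i)" using that \<B>(2) by (auto simp: \<P>_def PiE_iff)
      then show "openin X {x \<in> topspace X. (T ^^ (i * n)) x \<in> W i}"
        using openin_continuous_map_preimage continuous_map_funpow[OF T] by blast
    qed (use d in auto)
  qed
  moreover have "dense_in X (G W)" if W: "W \<in> \<P>" for W
    unfolding dense_in_def dense_intersects_open
  proof (intro conjI allI impI)
    show "G W \<subseteq> topspace X" by (auto simp: G_iff)
    fix V assume V: "openin X V \<and> V \<noteq> {}"
    \<comment> \<open>With \<open>V\<close> put in front, a hitting time of the \<open>d + 1\<close>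
      sets yields a point of \<open>V\<close> that visits \<open>W i\<close> at time
      \<open>i * n\<close>.\<close>
    define U where "U i = (if i = 1 then V else W (i - 1))" for i
    have "nonempty_opens X (d + 1) U"
      unfolding nonempty_opens_def
    proof
      fix i assume "i \<in> {1..d+1}"
      then have "i = 1 \<or> i - 1 \<in> {1..d}" by auto
      then show "openin X (U i) \<and> U i \<noteq> {}"
        using V W \<B>(2) by (auto simp: U_def \<P>_def PiE_iff)
    qed
    then obtain n where "n \<in> hitting_times X T (d + 1) U"
      using H d unfolding always_hitting_def by (metis all_not_in_conv trans_le_add1)
    then obtain x where x: "x \<in> topspace X" "\<And>i. i \<in> {1..d+1} \<Longrightarrow> (T ^^ ((i - 1) * n)) x \<in> U i"
      by (rule hitting_timesE) (auto 4 3)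
    have "x \<in> V" using x(2)[of 1] by (simp add: U_def)
    moreover have "(T ^^ (i * n)) x \<in> W i" if "i \<in> {1..d}" for i
      using x(2)[of "i + 1"] that by (simp add: U_def)
    then have "x \<in> G W"
      using x(1) unfolding G_iff by blast
    ultimately show "G W \<inter> V \<noteq> {}" by blast
  qed
  moreover have "countable (G ` \<P>)"
    unfolding \<P>_def using \<B>(1) by (intro countable_image countable_PiE) auto
  ultimately have "residual_in X R"
    unfolding residual_in_def R_def by blast
  moreover have "dense_in (power_top d X) (range (\<lambda>n::nat. \<lambda>i\<in>{1..d}. (T ^^ (i * n)) x))"
    if x: "x \<in> R" for x
    unfolding dense_in_power_top_iff
  proof (intro conjI allI impI)
    show "range (\<lambda>n::nat. \<lambda>i\<in>{1..d}. (T ^^ (i * n)) x) \<subseteq> topspace (power_top d X)"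
      using x by (intro progression_in_power_top[OF T]) (simp add: R_def)
    fix U assume U: "nonempty_opens X d U"
    have "\<exists>V\<in>\<B> - {{}}. V \<subseteq> U i" if "i \<in> {1..d}" for i
    proof -
      have "openin X (U i)" "U i \<noteq> {}"
        using U that by (auto simp: nonempty_opens_def)
      then show ?thesis using base by (metis Diff_iff all_not_in_conv empty_iff singletonD)
    qed
    then obtain V where V: "\<And>i. i \<in> {1..d} \<Longrightarrow> V i \<in> \<B> - {{}} \<and> V i \<subseteq> U i"
      by metis
    have "restrict V {1..d} \<in> \<P>"
      unfolding \<P>_def using V by auto
    then have "x \<in> G (restrict V {1..d})"
      using x unfolding R_def by blast
    then obtain n where "\<forall>i\<in>{1..d}. (T ^^ (i * n)) x \<in> restrict V {1..d} i"
      unfolding G_iff by blast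
    then have "\<forall>i\<in>{1..d}. (\<lambda>i\<in>{1..d}. (T ^^ (i * n)) x) i \<in> U i"
      using V by force
    then show "\<exists>s\<in>range (\<lambda>n::nat. \<lambda>i\<in>{1..d}. (T ^^ (i * n)) x). \<forall>i\<in>{1..d}. s i \<in> U i"
      by blast
  qed
  ultimately show "\<exists>R. residual_in X R \<and>
      (\<forall>x\<in>R. dense_in (power_top d X) (range (\<lambda>n::nat. \<lambda>i\<in>{1..d}. (T ^^ (i * n)) x)))"
    by blast
qed

section \<open>Concatenated families and filter bases\<close>

lemma hitting_times_append:
  assumes T: "continuous_map X X T" and d: "1 \<le> d" and e: "1 \<le> e"
    and W: "\<And>i. W i = (if i \<le> d then U i else V (i - d))"
  shows "hitting_times X T (d + e) W \<subseteq> hitting_times X T d U \<inter> hitting_times X T e V"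
proof
  fix n assume "n \<in> hitting_times X T (d + e) W"
  moreover have "1 \<le> d + e" using d by simp
  ultimately obtain x where n: "1 \<le> n" and x: "x \<in> topspace X"
      "\<And>i. i \<in> {1..d+e} \<Longrightarrow> (T ^^ ((i - 1) * n)) x \<in> W i"
    by (rule hitting_timesE) blast
  have "\<forall>i\<in>{1..d}. (T ^^ ((i - 1) * n)) x \<in> U i"
    using x(2) W by fastforce
  then have "n \<in> hitting_times X T d U"
    using n x(1) by (intro hitting_timesI) auto
  \<comment> \<open>Starting from T^(dn) x shifts the index by \<open>d\<close>. As \<open>i\<close>
    is at least 1, truncated subtraction is harmless and \<open>W (i + d)\<close> is
    \<open>V i\<close>.\<close>
  moreover have "(T ^^ ((i - 1) * n)) ((T ^^ (d * n)) x) \<in> V i" if i: "i \<in> {1..e}" for i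
  proof -
    have "(i - 1) * n + d * n = (i + d - 1) * n"
      using i by (simp flip: add_mult_distrib)
    then have "(T ^^ ((i - 1) * n)) ((T ^^ (d * n)) x) = (T ^^ ((i + d - 1) * n)) x"
      by (metis comp_apply funpow_add)
    then show ?thesis
      using x(2)[of "i + d"] i W[of "i + d"] by simp
  qed
  then have "n \<in> hitting_times X T e V"
    using n funpow_in_topspace[OF T x(1)] by (intro hitting_timesI) auto
  ultimately show "n \<in> hitting_times X T d U \<inter> hitting_times X T e V" by blast
qed

lemma nonempty_opens_append:
  assumes "nonempty_opens X d U" "nonempty_opens X e V"
  shows "nonempty_opens X (d + e) (\<lambda>i. if i \<le> d then U i else V (i - d))"
  unfolding nonempty_opens_def
proof
  fix i assume "i \<in> {1..d+e}"
  then have "i \<in> {1..d} \<or> \<not> i \<le> d \<and> i - d \<in> {1..e}" by auto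
  then show "openin X (if i \<le> d then U i else V (i - d)) \<and> (if i \<le> d then U i else V (i - d)) \<noteq> {}"
    using assms by (auto simp: nonempty_opens_def)
qed

lemma always_hitting_iff_filter_base:
  assumes "dynamical_system X T"
  shows "always_hitting X T \<longleftrightarrow>
    filter_base {hitting_times X T d U | d U. d \<ge> 2 \<and> nonempty_opens X d U}"
    (is "_ \<longleftrightarrow> filter_base ?\<F>")
proof
  assume H: "always_hitting X T"
  show "filter_base ?\<F>"
    unfolding filter_base_def
  proof (intro ballI)
    fix F1 F2 assume "F1 \<in> ?\<F>" "F2 \<in> ?\<F>"
    then obtain d U e V where dU: "F1 = hitting_times X T d U" "2 \<le> d" "nonempty_opens X d U"
        and eV: "F2 = hitting_times X T e V" "2 \<le> e" "nonempty_opens X e V"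
      by blast
    define W where "W = (\<lambda>i. if i \<le> d then U i else V (i - d))"
    have W: "nonempty_opens X (d + e) W" "2 \<le> d + e"
      unfolding W_def using nonempty_opens_append dU eV by auto
    moreover have "hitting_times X T (d + e) W \<subseteq> F1 \<inter> F2"
      using hitting_times_append[of X T d e W U V] assms dU eV
      by (auto simp: W_def dynamical_system_def)
    moreover have "hitting_times X T (d + e) W \<noteq> {}"
      using H W by (auto simp: always_hitting_def)
    ultimately show "\<exists>F\<in>?\<F>. F \<noteq> {} \<and> F \<subseteq> F1 \<inter> F2"
      by blast
  qed
next
  assume "filter_base ?\<F>"
  \<comment> \<open>Taking both members equal to \<open>F\<close> gives a non-empty subset of
    \<open>F\<close>.\<close>
  then have "F \<noteq> {}" if "F \<in> ?\<F>" for F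
    using that unfolding filter_base_def by blast
  then show "always_hitting X T"
    unfolding always_hitting_def by blast
qed

section \<open>Common hitting times and thickness\<close>

text \<open>Repeated concatenation gives one long family whose hitting times belong to all the given
  sets. The induction carries this family, since a common time for part of \<open>J\<close> says
  nothing about the next member.\<close>

lemma always_hitting_common_time:
  assumes T: "continuous_map X X T" and H: "always_hitting X T" and d: "2 \<le> d"
    and J: "finite J" "J \<noteq> {}" and U: "\<And>j. j \<in> J \<Longrightarrow> nonempty_opens X d (U j)"
  shows "\<exists>n. \<forall>j\<in>J. n \<in> hitting_times X T d (U j)"
proof -
  have "\<exists>e W. 2 \<le> e \<and> nonempty_opens X e W \<and> (\<forall>j\<in>J. hitting_times X T e W \<subseteq> hitting_times X T d (U j))"
    using J U
  proof (induction J rule: finite_ne_induct)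
    case (singleton j)
    then show ?case using d by blast
  next
    case (insert j J)
    then obtain e W where W: "2 \<le> e" "nonempty_opens X e W"
        "\<And>k. k \<in> J \<Longrightarrow> hitting_times X T e W \<subseteq> hitting_times X T d (U k)"
      by blast
    define W' where "W' = (\<lambda>i. if i \<le> d then U j i else W (i - d))"
    have "nonempty_opens X (d + e) W'"
      unfolding W'_def using nonempty_opens_append insert.prems W(2) by blast
    moreover have "hitting_times X T (d + e) W' \<subseteq> hitting_times X T d (U j) \<inter> hitting_times X T e W"
      using hitting_times_append[OF T, of d e W' "U j" W] d W(1) by (auto simp: W'_def)
    ultimately show ?case
      using W d by (intro exI[of _ "d + e"] exI[of _ W']) auto
  qed
  then show ?thesis
    using H unfolding always_hitting_def by blast
qed

text \<open>This keeps the pulled-back families in the thickness argument admissible. A return of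
  \<open>V\<close> to itself at a positive time n puts T^(n-1) x into the preimage of
  \<open>V\<close> under \<open>T\<close>, to which the induction hypothesis applies.\<close>

lemma always_hitting_preimage_nonempty:
  assumes T: "continuous_map X X T" and H: "always_hitting X T"
    and V: "openin X V" "V \<noteq> {}"
  shows "{x \<in> topspace X. (T ^^ k) x \<in> V} \<noteq> {}"
  using V
proof (induction k arbitrary: V)
  case 0
  then show ?case using openin_subset by fastforce
next
  case (Suc k)
  have "nonempty_opens X 2 (\<lambda>_. V)"
    using Suc.prems by (simp add: nonempty_opens_def)
  then obtain n where "n \<in> hitting_times X T 2 (\<lambda>_. V)"
    using H unfolding always_hitting_def by blast
  then obtain x where x: "1 \<le> n" "x \<in> topspace X"
      "\<And>i. i \<in> {1..2} \<Longrightarrow> (T ^^ ((i - 1) * n)) x \<in> V"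
    by (rule hitting_timesE) (auto 4 3)
  have "(T ^^ n) x \<in> V" using x(3)[of 2] by simp
  then have "(T ^^ (n - 1)) x \<in> {x \<in> topspace X. T x \<in> V}"
    using x(1) funpow_in_topspace[OF T x(2), of "n - 1"] by (cases n) auto
  then have "{x \<in> topspace X. T x \<in> V} \<noteq> {}" by blast
  moreover have "openin X {x \<in> topspace X. T x \<in> V}"
    using openin_continuous_map_preimage[OF T Suc.prems(1)] .
  ultimately have "{x \<in> topspace X. (T ^^ k) x \<in> {x \<in> topspace X. T x \<in> V}} \<noteq> {}"
    by (rule Suc.IH[rotated])
  then show ?case by auto
qed

lemma always_hitting_imp_thick:
  assumes T: "continuous_map X X T" and H: "always_hitting X T"
    and d: "2 \<le> d" and U: "nonempty_opens X d U"
  shows "thick (hitting_times X T d U)"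
  unfolding thick_def
proof (intro allI impI)
  fix N :: nat
  \<comment> \<open>Entry \<open>i\<close> is pulled back by the \<open>(i - 1) * j\<close> steps
    between times \<open>(i - 1) * n\<close> and \<open>(i - 1) * (n + j)\<close>. A hitting time
    \<open>n\<close> of \<open>V j\<close> thus makes \<open>n + j\<close> one of
    \<open>U\<close>.\<close>
  define V where "V j i = {x \<in> topspace X. (T ^^ ((i - 1) * j)) x \<in> U i}" for j i
  have "nonempty_opens X d (V j)" for j
    unfolding nonempty_opens_def V_def
    using U always_hitting_preimage_nonempty[OF T H]
      openin_continuous_map_preimage[OF continuous_map_funpow[OF T]]
    by (simp add: nonempty_opens_def)
  then obtain n where n: "\<And>j. j \<in> {..N} \<Longrightarrow> n \<in> hitting_times X T d (V j)"
    using always_hitting_common_time[OF T H d, of "{..N}" V] by auto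
  have "n + j \<in> hitting_times X T d U" if "j \<le> N" for j
  proof -
    have "n \<in> hitting_times X T d (V j)" "1 \<le> d" using n[of j] that d by auto
    then obtain x where x: "1 \<le> n" "x \<in> topspace X"
        "\<And>i. i \<in> {1..d} \<Longrightarrow> (T ^^ ((i - 1) * n)) x \<in> V j i"
      by (rule hitting_timesE) blast
    have "(T ^^ ((i - 1) * (n + j))) x \<in> U i" if "i \<in> {1..d}" for i
    proof -
      have "(T ^^ ((i - 1) * (n + j))) x = (T ^^ ((i - 1) * j)) ((T ^^ ((i - 1) * n)) x)"
        by (metis add.commute comp_apply distrib_left funpow_add)
      then show ?thesis using x(3)[OF that] by (simp add: V_def)
    qed
    then show ?thesis
      using x by (intro hitting_timesI[of _ x]) auto
  qed
  then have "{n..n + N} \<subseteq> hitting_times X T d U"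
    by (metis atLeastAtMost_iff le_add_diff_inverse nat_add_left_cancel_le subsetI)
  moreover have "1 \<le> n"
    using n[of 0] by (simp add: hitting_times_def)
  ultimately show "\<exists>n\<ge>1. {n..n + N} \<subseteq> hitting_times X T d U" by blast
qed

lemma always_hitting_iff_thick:
  assumes "dynamical_system X T"
  shows "always_hitting X T \<longleftrightarrow>
    (\<forall>d\<ge>2. \<forall>U. nonempty_opens X d U \<longrightarrow> thick (hitting_times X T d U))"
proof -
  have "F \<noteq> {}" if "thick F" for F
    using that unfolding thick_def by fastforce
  then show ?thesis
    using assms always_hitting_imp_thick unfolding always_hitting_def dynamical_system_def by meson
qed

section \<open>Passage to powers and back\<close>

lemma power_map_funpow_apply:
  assumes "i \<in> {1..m}"
  shows "(power_map m T ^^ k) x i = (T ^^ k) (x i)"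
  by (induction k) (use assms in \<open>auto simp: power_map_def\<close>)

text \<open>Each \<open>U i\<close> is shrunk to a box. A time common to the families of all
  coordinates gives one point of \<open>X\<close> per coordinate, and these points form the required
  point of the power.\<close>

lemma always_hitting_power:
  assumes X: "dynamical_system X T" and H: "always_hitting X T" and m: "1 \<le> m"
  shows "always_hitting (power_top m X) (power_map m T)"
  unfolding always_hitting_def
proof (intro allI impI)
  fix d :: nat and U assume d: "2 \<le> d" and U: "nonempty_opens (power_top m X) d U"
  have T: "continuous_map X X T" using X by (simp add: dynamical_system_def)
  have P: "continuous_map (power_top m X) (power_top m X) (power_map m T)"
    using dynamical_system_power[OF X] by (simp add: dynamical_system_def)
  have "\<exists>B. nonempty_opens X m B \<and> Pi\<^sub>E {1..m} B \<subseteq> U i" if "i \<in> {1..d}" for i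
  proof -
    have "openin (power_top m X) (U i)" "U i \<noteq> {}"
      using U that by (auto simp: nonempty_opens_def)
    moreover from this obtain v where "v \<in> U i" by blast
    ultimately obtain B where "\<forall>j\<in>{1..m}. openin X (B j)" "v \<in> Pi\<^sub>E {1..m} B" "Pi\<^sub>E {1..m} B \<subseteq> U i"
      unfolding power_top_def openin_product_topology_alt by blast
    then have "nonempty_opens X m B"
      by (auto simp: nonempty_opens_def PiE_iff)
    then show ?thesis using \<open>Pi\<^sub>E {1..m} B \<subseteq> U i\<close> by blast
  qed
  then obtain B where B: "\<And>i. i \<in> {1..d} \<Longrightarrow> nonempty_opens X m (B i)"
      "\<And>i. i \<in> {1..d} \<Longrightarrow> Pi\<^sub>E {1..m} (B i) \<subseteq> U i"
    by metis
  \<comment> \<open>Transposition: \<open>B i\<close> is the box inside \<open>U i\<close>; fixing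
    the coordinate \<open>j\<close> instead gives a family in \<open>X\<close>.\<close>
  have "nonempty_opens X d (\<lambda>i. B i j)" if "j \<in> {1..m}" for j
    using B(1) that by (auto simp: nonempty_opens_def)
  then obtain n where n: "\<And>j. j \<in> {1..m} \<Longrightarrow> n \<in> hitting_times X T d (\<lambda>i. B i j)"
    using always_hitting_common_time[OF T H d, of "{1..m}" "\<lambda>j i. B i j"] m by force
  then have "1 \<le> n"
    using m by (fastforce simp: hitting_times_def)
  have "\<exists>x\<in>topspace X. \<forall>i\<in>{1..d}. (T ^^ ((i - 1) * n)) x \<in> B i j" if "j \<in> {1..m}" for j
  proof -
    have "1 \<le> d" using d by simp
    with n[OF that] show ?thesis by (rule hitting_timesE) blast
  qed
  then obtain x where x: "\<And>j. j \<in> {1..m} \<Longrightarrow> x j \<in> topspace X"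
      "\<And>i j. j \<in> {1..m} \<Longrightarrow> i \<in> {1..d} \<Longrightarrow> (T ^^ ((i - 1) * n)) (x j) \<in> B i j"
    by metis
  define y where "y = restrict x {1..m}"
  have y: "y \<in> topspace (power_top m X)"
    using x(1) by (auto simp: y_def power_top_def)
  have "(power_map m T ^^ ((i - 1) * n)) y \<in> U i" if i: "i \<in> {1..d}" for i
  proof -
    \<comment> \<open>This supplies extensionality of the iterate; its coordinates are handled by
      \<open>x\<close>.\<close>
    have "(power_map m T ^^ ((i - 1) * n)) y \<in> topspace (power_top m X)"
      using funpow_in_topspace[OF P y] .
    then have "(power_map m T ^^ ((i - 1) * n)) y \<in> Pi\<^sub>E {1..m} (B i)"
      using x(2) i by (auto simp: power_top_def PiE_iff power_map_funpow_apply y_def)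
    then show ?thesis using B(2)[OF i] by blast
  qed
  then have "n \<in> hitting_times (power_top m X) (power_map m T) d U"
    using \<open>1 \<le> n\<close> y by (intro hitting_timesI) auto
  then show "hitting_times (power_top m X) (power_map m T) d U \<noteq> {}" by blast
qed

text \<open>The first coordinate projection intertwines the two maps, so families pull back along it
  and witnesses push forward.\<close>

lemma always_hitting_of_power:
  assumes m: "1 \<le> m" and H: "always_hitting (power_top m X) (power_map m T)"
  shows "always_hitting X T"
  unfolding always_hitting_def
proof (intro allI impI)
  fix d :: nat and U assume d: "2 \<le> d" and U: "nonempty_opens X d U"
  define V where "V i = {x \<in> topspace (power_top m X). x 1 \<in> U i}" for i
  have "nonempty_opens (power_top m X) d V"
    unfolding nonempty_opens_def
  proof
    fix i assume "i \<in> {1..d}"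
    then have "openin X (U i)" "U i \<noteq> {}"
      using U by (auto simp: nonempty_opens_def)
    then obtain u where u: "openin X (U i)" "u \<in> U i" by blast
    then have "(\<lambda>_\<in>{1..m}. u) \<in> V i"
      using m openin_subset[OF u(1)] by (auto simp: V_def power_top_def)
    moreover have "continuous_map (power_top m X) X (\<lambda>x. x 1)"
      unfolding power_top_def using m by (intro continuous_map_product_projection) auto
    then have "openin (power_top m X) (V i)"
      unfolding V_def using openin_continuous_map_preimage u(1) by blast
    ultimately show "openin (power_top m X) (V i) \<and> V i \<noteq> {}" by blast
  qed
  then obtain n where "n \<in> hitting_times (power_top m X) (power_map m T) d V"
    using H d unfolding always_hitting_def by blast
  moreover have "1 \<le> d" using d by simp
  ultimately obtain x where x: "1 \<le> n" "x \<in> topspace (power_top m X)"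
      "\<And>i. i \<in> {1..d} \<Longrightarrow> (power_map m T ^^ ((i - 1) * n)) x \<in> V i"
    by (rule hitting_timesE) blast
  have "x 1 \<in> topspace X"
    using x(2) m by (auto simp: power_top_def)
  moreover have "(T ^^ ((i - 1) * n)) (x 1) \<in> U i" if "i \<in> {1..d}" for i
    using x(3)[OF that] m by (simp add: V_def power_map_funpow_apply)
  ultimately have "n \<in> hitting_times X T d U"
    using x(1) by (intro hitting_timesI) auto
  then show "hitting_times X T d U \<noteq> {}" by blast
qed

section \<open>Equivalence of the four conditions\<close>

lemma Delta_transitive_iff_always_hitting:
  assumes "dynamical_system X T"
  shows "Delta_transitive X T \<longleftrightarrow> always_hitting X T"
  using assms Delta_transitive_imp_always_hitting always_hitting_imp_Delta_transitive by blast

theorem proposition3p2: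
  fixes X :: "'a topology" and T :: "'a \<Rightarrow> 'a"
  assumes "dynamical_system X T"
  shows "(Delta_transitive X T \<longleftrightarrow>
            filter_base {hitting_times X T d U | d U. d \<ge> 2 \<and> nonempty_opens X d U})
       \<and> (filter_base {hitting_times X T d U | d U. d \<ge> 2 \<and> nonempty_opens X d U} \<longleftrightarrow>
            (\<forall>d\<ge>2. \<forall>U. nonempty_opens X d U \<longrightarrow> thick (hitting_times X T d U)))
       \<and> ((\<forall>d\<ge>2. \<forall>U. nonempty_opens X d U \<longrightarrow> thick (hitting_times X T d U)) \<longleftrightarrow>
            (\<forall>m\<ge>2. Delta_transitive (power_top m X) (power_map m T)))"
proof -
  have "(\<forall>m\<ge>2. Delta_transitive (power_top m X) (power_map m T)) \<longleftrightarrow>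
      (\<forall>m\<ge>2. always_hitting (power_top m X) (power_map m T))"
    using Delta_transitive_iff_always_hitting dynamical_system_power[OF assms] by blast
  \<comment> \<open>For the direction from powers to \<open>X\<close>, the single power
    \<open>m = 2\<close> suffices.\<close>
  also have "\<dots> \<longleftrightarrow> always_hitting X T"
    using always_hitting_power[OF assms] always_hitting_of_power[of 2 X T] by auto
  finally show ?thesis
    unfolding Delta_transitive_iff_always_hitting[OF assms]
      always_hitting_iff_filter_base[OF assms, symmetric] always_hitting_iff_thick[OF assms, symmetric]
    by blast
qed

end
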